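(* Let $n\ge 4$ be even, let $1\le m\le n/2$, let $\alpha_0,\ldots,\alpha_{n-2}\in\mathbb{D}$, and let $\zeta_1,\ldots,\zeta_{2m}$ be $2m$ distinct eigenvalues of the finite CMV matrix $\mathcal{C}(\alpha_0,\ldots,\alpha_{n-2};1)$. Let $\omega_1,\ldots,\omega_{2m}$ be the numbers defined in the context (they depend only on $\alpha_0,\ldots,\alpha_{n-m-2}$ and $\zeta_1,\ldots,\zeta_{2m}$), and consider the interpolation problem $$P^{(1)}(\zeta_j)-\omega_jP^{(2)}(\zeta_j)=0,\qquad j=1,\ldots,2m, \qquad (I_{2m})$$ for pairs of complex polynomials $(P^{(1)},P^{(2)})$. Let $r=\begin{pmatrix}R^{(1)}\\R^{(2)}\end{pmatrix}$ be a minimal generator of $(I_{2m})$ and suppose that $R^{(1)}(0)\ne0$. Then $(I_{2m})$ has a unique solution $(P^{(1)},P^{(2)})$ such that $P^{(1)}$ is monic of degree $m+1$, $P^{(2)}$ is monic of degree $m$, and $P^{(1)}(0)=-1$. Hence the solution of the mixed inverse spectral problem is unique, i.e., if $\alpha'_{n-m-1},\ldots,\alpha'_{n-2}\in\mathbb{D}$ are such that $\zeta_1,\ldots,\zeta_{2m}$ are eigenvalues of $\mathcal{C}(\alpha_0,\ldots,\alpha_{n-m-2},\alpha'_{n-m-1},\ldots,\alpha'_{n-2};1)$, then $\alpha'_k=\alpha_k$ for $k=n-m-1,\ldots,n-2$.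
   Context: $\mathbb{D}=\{z\in\mathbb{C}:|z|<1\}$. Finite CMV matrix. For $n=2l$ even and $\alpha_0,\ldots,\alpha_{n-2}\in\mathbb{D}$, $\mathcal{C}(\alpha_0,\ldots,\alpha_{n-2};1)=\mathcal{L}\mathcal{M}$ is the $n\times n$ unitary matrix with the block-diagonal factors $\mathcal{L}=\mathrm{diag}(\Theta(\alpha_0),\Theta(\alpha_2),\ldots,\Theta(\alpha_{2l-2}))$ and $\mathcal{M}=\mathrm{diag}(1,\Theta(\alpha_1),\Theta(\alpha_3),\ldots,\Theta(\alpha_{2l-3}),1)$, where $\Theta(\alpha)=\begin{pmatrix}\bar\alpha&\rho\\ \rho&-\alpha\end{pmatrix}$, $\rho=\sqrt{1-|\alpha|^2}$. Its eigenvalues are simple and lie on the unit circle. Szegő polynomials. $\Phi_0\equiv1$, $\Phi_k(z)=z\Phi_{k-1}(z)-\bar\alpha_{k-1}\Phi^*_{k-1}(z)$, where $\Phi_k^*(z)=z^k\overline{\Phi_k(1/\bar z)}$. Put $\widetilde\Phi_{n-m-1}(z)=z\Phi_{n-m-2}(z)-\Phi^*_{n-m-2}(z)$ and $W(z)=\widetilde\Phi_{n-m-1}(z)/\Phi_{n-m-2}(z)$. The data of the interpolation problem are $$\omega_j=\zeta_j\,\frac{(1+\bar\alpha_{n-m-2})\{1-\alpha_{n-m-2}-\bar\zeta_jW(\zeta_j)\}-(1-|\alpha_{n-m-2}|^2)}{1-\alpha_{n-m-2}-\bar\zeta_jW(\zeta_j)},\qquad j=1,\ldots,2m$$ (the denominators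 do not vanish). Height and minimal generator. For a nonzero pair $p=\begin{pmatrix}P^{(1)}\\P^{(2)}\end{pmatrix}$ of complex polynomials the height is $h(p)=\max\{2\deg P^{(1)},\,2\deg P^{(2)}+1\}$, with $\deg 0=-\infty$. A minimal generator of $(I_{2m})$ is a nonzero solution of $(I_{2m})$ having the smallest height among all nonzero solutions. The mixed inverse spectral problem (MISP): given $\alpha_0,\ldots,\alpha_{n-m-2}$ and $2m$ eigenvalues $\zeta_1,\ldots,\zeta_{2m}$ of $\mathcal{C}(\alpha_0,\ldots,\alpha_{n-2};1)$, find the remaining parameters $\alpha_{n-m-1},\ldots,\alpha_{n-2}\in\mathbb{D}$. *)

theory Defs
  imports "Jordan_Normal_Form.Char_Poly" "HOL-Library.Extended_Real"
begin

section \<open>Finite CMV matrices\<close>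

definition Theta :: "complex \<Rightarrow> complex mat" where
  "Theta a = (let \<rho> = complex_of_real (sqrt (1 - (cmod a)\<^sup>2)) in
     mat_of_rows_list 2 [[cnj a, \<rho>], [\<rho>, - a]])"

definition cmv_L :: "nat \<Rightarrow> (nat \<Rightarrow> complex) \<Rightarrow> complex mat" where
  "cmv_L l \<alpha> = diag_block_mat (map (\<lambda>k. Theta (\<alpha> (2 * k))) [0..<l])"

definition cmv_M :: "nat \<Rightarrow> (nat \<Rightarrow> complex) \<Rightarrow> complex mat" where
  "cmv_M l \<alpha> = diag_block_mat
     (1\<^sub>m 1 # map (\<lambda>k. Theta (\<alpha> (2 * k + 1))) [0..<l - 1] @ [1\<^sub>m 1])"

text \<open>\<open>cmv n \<alpha>\<close> is \<open>\<C>(\<alpha>\<^sub>0, \<dots>, \<alpha>\<^sub>n\<^sub>-\<^sub>2; 1)\<close>, meant for even \<open>n \<ge> 2\<close>;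
  only the values of \<open>\<alpha>\<close> at indices up to \<open>n - 2\<close> enter.\<close>

definition cmv :: "nat \<Rightarrow> (nat \<Rightarrow> complex) \<Rightarrow> complex mat" where
  "cmv n \<alpha> = cmv_L (n div 2) \<alpha> * cmv_M (n div 2) \<alpha>"

lemma dim_Theta [simp]: "dim_row (Theta a) = 2" "dim_col (Theta a) = 2"
  by (simp_all add: Theta_def Let_def mat_of_rows_list_def)

lemma cmv_carrier:
  assumes "even n" "n \<ge> 2"
  shows "cmv n \<alpha> \<in> carrier_mat n n"
proof (rule carrier_matI)
  show "dim_row (cmv n \<alpha>) = n"
    using assms by (simp add: cmv_def cmv_L_def dim_diag_block_mat comp_def sum_list_triv)
  show "dim_col (cmv n \<alpha>) = n"
    using assms by (simp add: cmv_def cmv_M_def dim_diag_block_mat comp_def sum_list_triv) presburger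
qed


section \<open>Szego polynomials\<close>

text \<open>\<open>star_poly k p\<close> is the polynomial \<open>z\<^sup>k * cnj (p (1 / cnj z))\<close>, for \<open>degree p \<le> k\<close>.\<close>

definition star_poly :: "nat \<Rightarrow> complex poly \<Rightarrow> complex poly" where
  "star_poly k p = (\<Sum>i\<le>k. monom (cnj (coeff p (k - i))) i)"

lemma poly_star_poly:
  assumes "degree p \<le> k" "z \<noteq> 0"
  shows "poly (star_poly k p) z = z ^ k * cnj (poly p (1 / cnj z))"
proof -
  have "poly p w = (\<Sum>i\<le>k. coeff p i * w ^ i)" for w
    using assms(1) by (simp add: poly_altdef coeff_eq_0 sum.mono_neutral_left)
  then have "z ^ k * cnj (poly p (1 / cnj z)) = (\<Sum>i\<le>k. cnj (coeff p i) * z ^ (k - i))"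
    using assms(2)
    by (auto simp: sum_distrib_left power_diff field_simps intro!: sum.cong)
  also have "\<dots> = (\<Sum>i\<le>k. cnj (coeff p (k - i)) * z ^ i)"
    by (rule sum.reindex_bij_witness[of _ "\<lambda>i. k - i" "\<lambda>i. k - i"]) auto
  finally show ?thesis
    by (simp add: star_poly_def poly_sum poly_monom)
qed

primrec Szego :: "(nat \<Rightarrow> complex) \<Rightarrow> nat \<Rightarrow> complex poly" where
  "Szego \<alpha> 0 = 1"
| "Szego \<alpha> (Suc k) =
     [:0, 1:] * Szego \<alpha> k - Polynomial.smult (cnj (\<alpha> k)) (star_poly k (Szego \<alpha> k))"

lemma degree_star_poly: "degree (star_poly k p) \<le> k"
  unfolding star_poly_def
  by (rule degree_sum_le) (auto intro: order_trans[OF degree_monom_le])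

lemma degree_Szego: "degree (Szego \<alpha> k) \<le> k"
proof (induction k)
  case (Suc k)
  have "degree ([:0, 1:] * Szego \<alpha> k) \<le> Suc k"
    using degree_mult_le[of "[:0, 1:]" "Szego \<alpha> k"] Suc by simp
  moreover have "degree (Polynomial.smult (cnj (\<alpha> k)) (star_poly k (Szego \<alpha> k))) \<le> Suc k"
    using degree_smult_le[of "cnj (\<alpha> k)" "star_poly k (Szego \<alpha> k)"]
      degree_star_poly[of k "Szego \<alpha> k"] by linarith
  ultimately show ?case by (auto intro: degree_diff_le)
qed simp

text \<open>The step from \<open>k\<close> to \<open>k + 1\<close> with the last parameter replaced by \<open>1\<close>.\<close>

definition Szego_tilde :: "(nat \<Rightarrow> complex) \<Rightarrow> nat \<Rightarrow> complex poly" where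
  "Szego_tilde \<alpha> k = [:0, 1:] * Szego \<alpha> k - star_poly k (Szego \<alpha> k)"


section \<open>The interpolation problem\<close>

text \<open>In the notation of the mixed inverse spectral problem, \<open>N = n - m - 2\<close> is the largest
  index of a given parameter.\<close>

definition W :: "(nat \<Rightarrow> complex) \<Rightarrow> nat \<Rightarrow> complex \<Rightarrow> complex" where
  "W \<alpha> N z = poly (Szego_tilde \<alpha> N) z / poly (Szego \<alpha> N) z"

definition omega :: "(nat \<Rightarrow> complex) \<Rightarrow> nat \<Rightarrow> complex \<Rightarrow> complex" where
  "omega \<alpha> N z =
     z * (((1 + cnj (\<alpha> N)) * (1 - \<alpha> N - cnj z * W \<alpha> N z)
            - complex_of_real (1 - (cmod (\<alpha> N))\<^sup>2))
          / (1 - \<alpha> N - cnj z * W \<alpha> N z))"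

definition solves_interp ::
  "nat \<Rightarrow> (nat \<Rightarrow> complex) \<Rightarrow> (nat \<Rightarrow> complex) \<Rightarrow> complex poly \<times> complex poly \<Rightarrow> bool" where
  "solves_interp M \<zeta> \<omega> p \<longleftrightarrow>
     (\<forall>j\<in>{1..M}. poly (fst p) (\<zeta> j) - \<omega> j * poly (snd p) (\<zeta> j) = 0)"

definition edegree :: "complex poly \<Rightarrow> ereal" where
  "edegree p = (if p = 0 then - \<infinity> else ereal (real (degree p)))"

definition height :: "complex poly \<times> complex poly \<Rightarrow> ereal" where
  "height p = max (2 * edegree (fst p)) (2 * edegree (snd p) + 1)"

definition minimal_generator ::
  "nat \<Rightarrow> (nat \<Rightarrow> complex) \<Rightarrow> (nat \<Rightarrow> complex) \<Rightarrow> complex poly \<times> complex poly \<Rightarrow> bool" where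
  "minimal_generator M \<zeta> \<omega> r \<longleftrightarrow>
     r \<noteq> (0, 0) \<and> solves_interp M \<zeta> \<omega> r \<and>
     (\<forall>p. p \<noteq> (0, 0) \<and> solves_interp M \<zeta> \<omega> p \<longrightarrow> height r \<le> height p)"

end

theory Submission
  imports Defs "HOL-Computational_Algebra.Field_as_Ring"
    "HOL-Computational_Algebra.Polynomial_Factorial"
    "HOL-Computational_Algebra.Fundamental_Theorem_Algebra"
begin

text \<open>Write \<open>K = n - m - 1\<close> and \<open>p\<^sup>*\<close> for the reversed polynomial. An eigenvector of the CMV matrix,
  read together with its image under the factor \<open>\<M>\<close>, follows the Szego recursion entry by entry,
  and the last entry forces \<open>\<zeta> \<Phi>\<^sub>n\<^sub>-\<^sub>1(\<zeta>) = \<Phi>\<^sub>n\<^sub>-\<^sub>1\<^sup>*(\<zeta>)\<close>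
  (\<open>eigenvalue_cmv_root\<close>). Every such root is on the unit circle (\<open>Szego_tilde_root_unimodular\<close>).

  The last \<open>m\<close> steps of the recursion can be run backwards from the end: reversing their order and
  replacing each parameter \<open>\<alpha>\<close> by \<open>- cnj \<alpha>\<close> gives a Szego polynomial \<open>A\<close> of degree \<open>m\<close> with
  \<open>z \<Phi>\<^sub>n\<^sub>-\<^sub>1 - \<Phi>\<^sub>n\<^sub>-\<^sub>1\<^sup>* = z A \<Phi>\<^sub>K - A\<^sup>* \<Phi>\<^sub>K\<^sup>*\<close>
  (\<open>Szego_tilde_split\<close>). On the other hand \<open>\<omega> = \<zeta> (1 - \<Phi>\<^sub>K(\<zeta>) / \<Phi>\<^sub>K\<^sup>*(\<zeta>))\<close>
  (\<open>omega_eq\<close>). So at every eigenvalue the pair \<open>(z A - A\<^sup>*, A)\<close> satisfies the interpolation condition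
  (\<open>tail_poly_interpolates\<close>), and it has the required normalization.

  For uniqueness, let \<open>D\<close> be the difference of two normalized solutions. If it is not zero, it has
  height at most \<open>2 m\<close>, and so has the minimal generator \<open>R\<close>. The cross product of two solutions
  vanishes at the \<open>2 m\<close> nodes, and \<open>R\<^sup>(\<^sup>1\<^sup>) D\<^sup>(\<^sup>2\<^sup>) - R\<^sup>(\<^sup>2\<^sup>) D\<^sup>(\<^sup>1\<^sup>)\<close> has degree
  below \<open>2 m\<close>, so it is zero. Since \<open>D\<^sup>(\<^sup>1\<^sup>)(0) = 0\<close> and \<open>R\<^sup>(\<^sup>1\<^sup>)(0) \<noteq> 0\<close>, both components of \<open>D\<close>
  vanish at \<open>0\<close>, and \<open>D / z\<close> is again a solution. It is so small that its cross product with
  \<open>(z A - A\<^sup>*, A)\<close> is zero too; but these two polynomials are coprime, so \<open>D / z\<close>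
  would be a multiple of a pair of larger degree (\<open>normalized_solution_unique\<close>). Finally \<open>A\<close>
  determines its parameters (\<open>Szego_inject\<close>), which settles the inverse problem.\<close>


section \<open>Szego polynomials and their reversals\<close>

abbreviation Szego_star :: "(nat \<Rightarrow> complex) \<Rightarrow> nat \<Rightarrow> complex poly" where
  "Szego_star \<alpha> k \<equiv> star_poly k (Szego \<alpha> k)"

lemma coeff_star_poly: "coeff (star_poly k p) i = (if i \<le> k then cnj (coeff p (k - i)) else 0)"
  by (simp add: star_poly_def coeff_sum sum.delta)

lemma Szego_star_Suc:
  "Szego_star \<alpha> (Suc k) = Szego_star \<alpha> k - Polynomial.smult (\<alpha> k) ([:0, 1:] * Szego \<alpha> k)"
proof (rule poly_eqI)
  fix i
  have "coeff (Szego \<alpha> k) i = 0" if "i > k" for i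
    using that degree_Szego[of \<alpha> k] by (simp add: coeff_eq_0)
  moreover have "k - j = Suc x \<Longrightarrow> k - Suc j = x" for j x
    by simp
  ultimately show "coeff (Szego_star \<alpha> (Suc k)) i
      = coeff (Szego_star \<alpha> k - Polynomial.smult (\<alpha> k) ([:0, 1:] * Szego \<alpha> k)) i"
    by (cases i) (auto simp: coeff_star_poly coeff_pCons Suc_diff_le split: nat.splits)
qed

lemma poly_Szego_Suc:
  "poly (Szego \<alpha> (Suc k)) z = z * poly (Szego \<alpha> k) z - cnj (\<alpha> k) * poly (Szego_star \<alpha> k) z"
  by simp

lemma poly_Szego_star_Suc:
  "poly (Szego_star \<alpha> (Suc k)) z = poly (Szego_star \<alpha> k) z - \<alpha> k * (z * poly (Szego \<alpha> k) z)"
  unfolding Szego_star_Suc by simp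

(* The simplifier would otherwise expand the argument of star_poly, where Szego_star_Suc applies. *)
declare Szego.simps(2) [simp del]

lemma poly_Szego_tilde:
  "poly (Szego_tilde \<alpha> k) z = z * poly (Szego \<alpha> k) z - poly (Szego_star \<alpha> k) z"
  by (simp add: Szego_tilde_def)

lemma Szego_cong: "(\<And>i. i < k \<Longrightarrow> \<alpha> i = \<beta> i) \<Longrightarrow> Szego \<alpha> k = Szego \<beta> k"
  by (induction k) (auto simp: Szego.simps(2))

lemma lead_coeff_Szego: "degree (Szego \<alpha> k) = k \<and> lead_coeff (Szego \<alpha> k) = 1"
proof -
  have "coeff (Szego \<alpha> k) k = 1"
    by (induction k) (simp_all add: Szego.simps(2) coeff_star_poly)
  moreover from this have "k \<le> degree (Szego \<alpha> k)"
    by (intro le_degree) simp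
  ultimately show ?thesis
    using degree_Szego[of \<alpha> k] by (metis le_antisym)
qed

lemma poly_Szego_star_0: "poly (Szego_star \<alpha> k) 0 = 1"
proof -
  have "coeff (Szego \<alpha> k) k = 1"
    using lead_coeff_Szego[of \<alpha> k] by metis
  then show ?thesis
    by (simp add: poly_0_coeff_0 coeff_star_poly)
qed

lemma cmod_less_one_complement_neq_0:
  assumes "cmod a < 1"
  shows "1 - a * cnj a \<noteq> 0"
proof
  assume "1 - a * cnj a = 0"
  then have "a * cnj a = 1" by simp
  then have "(cmod a)\<^sup>2 = 1"
    by (metis complex_norm_square of_real_eq_1_iff)
  with assms show False
    using norm_ge_zero[of a] by (simp add: power2_eq_1_iff)
qed

text \<open>Each recursion step multiplies the pair by a matrix of determinant \<open>z (1 - \<bar>\<alpha>\<bar>\<^sup>2)\<close>. Hence a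
  common zero can be traced back to the start, except perhaps \<open>z = 0\<close>, where the reversed
  polynomial takes the value \<open>1\<close>.\<close>

lemma Szego_no_common_zero:
  assumes "\<And>i. i < k \<Longrightarrow> cmod (\<alpha> i) < 1"
  shows "poly (Szego \<alpha> k) z \<noteq> 0 \<or> poly (Szego_star \<alpha> k) z \<noteq> 0"
  using assms
proof (induction k)
  case 0
  then show ?case by simp
next
  case (Suc k)
  show ?case
  proof (rule ccontr)
    let ?p = "poly (Szego \<alpha> k) z" and ?q = "poly (Szego_star \<alpha> k) z"
    assume "\<not> ?thesis"
    then have e: "z * ?p = cnj (\<alpha> k) * ?q" "?q = \<alpha> k * (z * ?p)"
      by (simp_all add: poly_Szego_Suc poly_Szego_star_Suc)
    have "?q * (1 - \<alpha> k * cnj (\<alpha> k)) = ?q - \<alpha> k * (cnj (\<alpha> k) * ?q)"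
      by (simp add: algebra_simps)
    also have "\<dots> = 0"
      by (simp only: e(1)[symmetric] e(2)[symmetric] diff_self)
    finally have "?q * (1 - \<alpha> k * cnj (\<alpha> k)) = 0" .
    then have q: "?q = 0"
      using cmod_less_one_complement_neq_0[of "\<alpha> k"] Suc.prems[of k] by simp
    have "z \<noteq> 0"
      using q poly_Szego_star_0[of k \<alpha>] by auto
    moreover have "z * ?p = 0"
      using e(1) q by simp
    ultimately have "?p = 0" by simp
    with q Suc show False by (meson less_SucI)
  qed
qed

text \<open>On the unit circle the two polynomials have equal modulus, so one vanishes only if both do.\<close>

lemma Szego_neq_0_on_circle:
  assumes "\<And>i. i < k \<Longrightarrow> cmod (\<alpha> i) < 1" and z: "cmod z = 1"
  shows "poly (Szego \<alpha> k) z \<noteq> 0" "poly (Szego_star \<alpha> k) z \<noteq> 0"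
proof -
  have "z * cnj z = 1"
    using z by (simp add: complex_norm_square[symmetric])
  then have "z \<noteq> 0" by auto
  with \<open>z * cnj z = 1\<close> have "1 / cnj z = z"
    by (simp add: field_simps)
  then have "poly (Szego_star \<alpha> k) z = z ^ k * cnj (poly (Szego \<alpha> k) z)"
    using poly_star_poly[OF degree_Szego, of z k \<alpha>] \<open>z \<noteq> 0\<close> by simp
  then show "poly (Szego \<alpha> k) z \<noteq> 0" "poly (Szego_star \<alpha> k) z \<noteq> 0"
    using Szego_no_common_zero[of k \<alpha> z] assms(1) \<open>z \<noteq> 0\<close> by auto
qed

text \<open>With \<open>x = z \<Phi>\<^sub>k(z)\<close> and \<open>y = \<Phi>\<^sub>k\<^sup>*(z)\<close> this is one recursion step: up to the factor
  \<open>1 - \<bar>a\<bar>\<^sup>2\<close>, the transfer matrix preserves the indefinite form \<open>\<bar>y\<bar>\<^sup>2 - \<bar>x\<bar>\<^sup>2\<close>.\<close>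

lemma Szego_norm_difference:
  "(cmod (y - a * x))\<^sup>2 - (cmod (x - cnj a * y))\<^sup>2 = (1 - (cmod a)\<^sup>2) * ((cmod y)\<^sup>2 - (cmod x)\<^sup>2)"
  unfolding cmod_power2 by (simp add: power2_eq_square algebra_simps)

text \<open>The sign of \<open>\<bar>\<Phi>\<^sub>k\<^sup>*\<bar>\<^sup>2 - \<bar>\<Phi>\<^sub>k\<bar>\<^sup>2\<close> depends only on the side of the unit circle, because
  the multiplication by \<open>z\<close> in each step changes this difference in the same direction.\<close>

lemma Szego_norm_le:
  assumes "\<And>i. i < k \<Longrightarrow> cmod (\<alpha> i) < 1"
  shows "(cmod z \<le> 1 \<longrightarrow> cmod (poly (Szego \<alpha> k) z) \<le> cmod (poly (Szego_star \<alpha> k) z)) \<and>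
         (cmod z \<ge> 1 \<longrightarrow> cmod (poly (Szego_star \<alpha> k) z) \<le> cmod (poly (Szego \<alpha> k) z))"
  using assms
proof (induction k)
  case 0
  then show ?case by (simp add: star_poly_def)
next
  case (Suc k)
  let ?p = "poly (Szego \<alpha> k) z" and ?q = "poly (Szego_star \<alpha> k) z"
  let ?p' = "poly (Szego \<alpha> (Suc k)) z" and ?q' = "poly (Szego_star \<alpha> (Suc k)) z"
  have diff: "(cmod ?q')\<^sup>2 - (cmod ?p')\<^sup>2 = (1 - (cmod (\<alpha> k))\<^sup>2) * ((cmod ?q)\<^sup>2 - (cmod (z * ?p))\<^sup>2)"
    unfolding poly_Szego_Suc poly_Szego_star_Suc by (rule Szego_norm_difference)
  have pos: "1 - (cmod (\<alpha> k))\<^sup>2 \<ge> 0"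
    using Suc.prems[of k] by (simp add: power_le_one)
  show ?case
  proof (intro conjI impI)
    assume z: "cmod z \<le> 1"
    have "cmod (z * ?p) \<le> 1 * cmod ?p"
      unfolding norm_mult using z by (intro mult_right_mono) auto
    also have "\<dots> \<le> cmod ?q"
      using Suc z by simp
    finally have "(cmod (z * ?p))\<^sup>2 \<le> (cmod ?q)\<^sup>2"
      by (intro power_mono) auto
    then have "(cmod ?p')\<^sup>2 \<le> (cmod ?q')\<^sup>2"
      using diff mult_nonneg_nonneg[OF pos, of "(cmod ?q)\<^sup>2 - (cmod (z * ?p))\<^sup>2"] by linarith
    then show "cmod ?p' \<le> cmod ?q'"
      by (rule power2_le_imp_le) simp
  next
    assume z: "cmod z \<ge> 1"
    have "cmod ?q \<le> 1 * cmod ?p"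
      using Suc z by simp
    also have "\<dots> \<le> cmod (z * ?p)"
      unfolding norm_mult using z by (intro mult_right_mono) auto
    finally have "(cmod ?q)\<^sup>2 \<le> (cmod (z * ?p))\<^sup>2"
      by (intro power_mono) auto
    then have "(cmod ?q')\<^sup>2 \<le> (cmod ?p')\<^sup>2"
      using diff mult_nonneg_nonpos[OF pos, of "(cmod ?q)\<^sup>2 - (cmod (z * ?p))\<^sup>2"] by linarith
    then show "cmod ?q' \<le> cmod ?p'"
      by (rule power2_le_imp_le) simp
  qed
qed

text \<open>A root has \<open>\<bar>z\<bar> \<bar>\<Phi>\<^sub>k\<bar> = \<bar>\<Phi>\<^sub>k\<^sup>*\<bar>\<close>, which off the circle contradicts the preceding
  inequality, as \<open>\<Phi>\<^sub>k\<close> and \<open>\<Phi>\<^sub>k\<^sup>*\<close> do not vanish together.\<close>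

lemma Szego_tilde_root_unimodular:
  assumes \<alpha>: "\<And>i. i < k \<Longrightarrow> cmod (\<alpha> i) < 1" and root: "poly (Szego_tilde \<alpha> k) z = 0"
  shows "cmod z = 1"
proof (rule ccontr)
  let ?p = "poly (Szego \<alpha> k) z" and ?q = "poly (Szego_star \<alpha> k) z"
  assume "cmod z \<noteq> 1"
  have e: "z * ?p = ?q"
    using root by (simp add: poly_Szego_tilde)
  then have en: "cmod z * cmod ?p = cmod ?q"
    by (metis norm_mult)
  have "?p \<noteq> 0"
    using e Szego_no_common_zero[of k \<alpha> z] \<alpha> by auto
  then have p: "cmod ?p > 0" by simp
  from \<open>cmod z \<noteq> 1\<close> consider "cmod z < 1" | "cmod z > 1" by linarith
  then show False
  proof cases
    case 1
    then have "cmod z * cmod ?p < 1 * cmod ?p"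
      using p by (intro mult_strict_right_mono)
    with en 1 Szego_norm_le[of k \<alpha> z] \<alpha> show False by simp
  next
    case 2
    then have "1 * cmod ?p < cmod z * cmod ?p"
      using p by (intro mult_strict_right_mono)
    with en 2 Szego_norm_le[of k \<alpha> z] \<alpha> show False by simp
  qed
qed

text \<open>Solving the recursion backwards: \<open>\<Phi>\<^sub>k\<^sub>+\<^sub>1(0) = - cnj \<alpha>\<^sub>k\<close> gives the last parameter, and then
  \<open>\<Phi>\<^sub>k\<^sub>+\<^sub>1 + cnj \<alpha>\<^sub>k \<Phi>\<^sub>k\<^sub>+\<^sub>1\<^sup>* = (1 - \<bar>\<alpha>\<^sub>k\<bar>\<^sup>2) z \<Phi>\<^sub>k\<close> gives the previous polynomial.\<close>

lemma Szego_inject: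
  assumes "\<And>i. i < k \<Longrightarrow> cmod (\<alpha> i) < 1" and "Szego \<alpha> k = Szego \<beta> k" and "i < k"
  shows "\<alpha> i = \<beta> i"
  using assms
proof (induction k)
  case 0
  then show ?case by simp
next
  case (Suc k)
  have "poly (Szego \<gamma> (Suc k)) 0 = - cnj (\<gamma> k)" for \<gamma>
    using poly_Szego_star_0[of k \<gamma>] by (simp add: poly_Szego_Suc)
  from this[of \<alpha>] this[of \<beta>] have eq: "\<alpha> k = \<beta> k"
    using Suc.prems(2) by simp
  let ?c = "1 - \<alpha> k * cnj (\<alpha> k)"
  have backward: "Szego \<gamma> (Suc k) + Polynomial.smult (cnj (\<gamma> k)) (Szego_star \<gamma> (Suc k))
      = Polynomial.smult ?c ([:0, 1:] * Szego \<gamma> k)" if "\<gamma> k = \<alpha> k" for \<gamma>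
    unfolding Szego_star_Suc unfolding Szego.simps(2) using that
    by (simp add: smult_diff_right smult_diff_left mult.commute)
  have "Polynomial.smult ?c ([:0, 1:] * Szego \<alpha> k)
      = Szego \<alpha> (Suc k) + Polynomial.smult (cnj (\<alpha> k)) (Szego_star \<alpha> (Suc k))"
    by (rule backward[of \<alpha>, OF refl, symmetric])
  also have "\<dots> = Szego \<beta> (Suc k) + Polynomial.smult (cnj (\<beta> k)) (Szego_star \<beta> (Suc k))"
    by (simp only: Suc.prems(2) eq)
  also have "\<dots> = Polynomial.smult ?c ([:0, 1:] * Szego \<beta> k)"
    by (rule backward[of \<beta>, OF eq[symmetric]])
  finally have "Polynomial.smult ?c ([:0, 1:] * (Szego \<alpha> k - Szego \<beta> k)) = 0"
    by (simp only: right_diff_distrib smult_diff_right diff_self)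
  moreover have "?c \<noteq> 0"
    using Suc.prems(1)[of k] by (intro cmod_less_one_complement_neq_0) simp
  ultimately have "Szego \<alpha> k = Szego \<beta> k"
    by simp
  with Suc eq show ?case
    by (metis less_Suc_eq)
qed


section \<open>Eigenvalues of finite CMV matrices\<close>

lemma diag_block_mat_offset_entry:
  assumes "\<And>A. A \<in> set As \<Longrightarrow> dim_row A = dim_col A"
    and "i < dim_row B" and "j < dim_col (diag_block_mat (As @ B # Bs))"
  shows "diag_block_mat (As @ B # Bs) $$ (sum_list (map dim_col As) + i, j)
    = (if sum_list (map dim_col As) \<le> j \<and> j < sum_list (map dim_col As) + dim_col B
       then B $$ (i, j - sum_list (map dim_col As)) else 0)"
  using assms
proof (induction As arbitrary: j)
  case Nil
  then show ?case by (auto simp: Let_def)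
next
  case (Cons A As)
  let ?D = "diag_block_mat (As @ B # Bs)" and ?s = "sum_list (map dim_col As)"
  have A: "dim_row A = dim_col A"
    using Cons.prems(1) by simp
  have "sum_list (map dim_row As) = ?s"
    using Cons.prems(1) by (intro arg_cong[where f = sum_list] map_cong) auto
  then have row: "?s + i < dim_row ?D"
    using Cons.prems(2) by (simp add: dim_diag_block_mat)
  have j: "j < dim_col A + dim_col ?D"
    using Cons.prems(3) by (simp add: Let_def)
  have "diag_block_mat ((A # As) @ B # Bs) $$ (dim_col A + ?s + i, j)
      = (if j < dim_col A then 0 else ?D $$ (?s + i, j - dim_col A))"
    using A row j by (auto simp: Let_def)
  also have "\<dots> = (if dim_col A + ?s \<le> j \<and> j < dim_col A + ?s + dim_col B
      then B $$ (i, j - (dim_col A + ?s)) else 0)"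
    using Cons.IH[of "j - dim_col A"] Cons.prems j by (auto simp: add.commute)
  finally show ?case by simp
qed

lemma diag_block_mat_mult_vec:
  assumes "\<And>A. A \<in> set As \<Longrightarrow> dim_row A = dim_col A"
    and i: "i < dim_row B" and v: "dim_vec v = dim_col (diag_block_mat (As @ B # Bs))"
    and s: "s = sum_list (map dim_col As)"
  shows "(diag_block_mat (As @ B # Bs) *\<^sub>v v) $ (s + i) = (\<Sum>j<dim_col B. B $$ (i, j) * v $ (s + j))"
proof -
  let ?D = "diag_block_mat (As @ B # Bs)"
  have "sum_list (map dim_row As) = s"
    unfolding s using assms(1) by (intro arg_cong[where f = sum_list] map_cong) auto
  then have row: "s + i < dim_row ?D"
    using i s by (simp add: dim_diag_block_mat)
  have col: "s + dim_col B \<le> dim_col ?D"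
    using s by (simp add: dim_diag_block_mat)
  have "(?D *\<^sub>v v) $ (s + i) = (\<Sum>j<dim_col ?D. ?D $$ (s + i, j) * v $ j)"
    using row v by (simp add: scalar_prod_def atLeast0LessThan)
  also have "\<dots> = (\<Sum>j<dim_col ?D.
      (if s \<le> j \<and> j < s + dim_col B then B $$ (i, j - s) else 0) * v $ j)"
    using diag_block_mat_offset_entry[OF assms(1) i, where Bs = Bs] s by (intro sum.cong) auto
  also have "\<dots> = (\<Sum>j\<in>{s..<s + dim_col B}. B $$ (i, j - s) * v $ j)"
    using col by (intro sum.mono_neutral_cong_right) auto
  also have "\<dots> = (\<Sum>j<dim_col B. B $$ (i, j) * v $ (s + j))"
    by (rule sum.reindex_bij_witness[of _ "\<lambda>j. s + j" "\<lambda>j. j - s"]) auto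
  finally show ?thesis .
qed

abbreviation rho :: "complex \<Rightarrow> complex" where
  "rho a \<equiv> complex_of_real (sqrt (1 - (cmod a)\<^sup>2))"

lemma Theta_index:
  "Theta a $$ (0, 0) = cnj a" "Theta a $$ (0, Suc 0) = rho a"
  "Theta a $$ (Suc 0, 0) = rho a" "Theta a $$ (Suc 0, Suc 0) = - a"
  by (simp_all add: Theta_def Let_def mat_of_rows_list_def)

lemma rho_square:
  assumes "cmod a < 1"
  shows "rho a \<noteq> 0" "rho a * rho a = 1 - a * cnj a"
proof -
  have "(cmod a)\<^sup>2 < 1"
    using assms by (simp add: abs_square_less_1)
  then show "rho a \<noteq> 0" "rho a * rho a = 1 - a * cnj a"
    by (simp_all add: of_real_mult[symmetric] complex_norm_square[symmetric] del: of_real_mult)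
qed

lemma upt_split: "k < l \<Longrightarrow> [0..<l] = [0..<k] @ k # [Suc k..<l]"
  by (metis le0 less_imp_le_nat upt_add_eq_append upt_conv_Cons le_add_diff_inverse)

lemma cmv_L_mult_vec:
  assumes k: "k < l" and v: "dim_vec v = 2 * l"
  shows "(cmv_L l \<alpha> *\<^sub>v v) $ (2 * k)
      = cnj (\<alpha> (2 * k)) * v $ (2 * k) + rho (\<alpha> (2 * k)) * v $ Suc (2 * k)" (is ?A)
    and "(cmv_L l \<alpha> *\<^sub>v v) $ Suc (2 * k)
      = rho (\<alpha> (2 * k)) * v $ (2 * k) - \<alpha> (2 * k) * v $ Suc (2 * k)" (is ?B)
proof -
  let ?f = "\<lambda>k. Theta (\<alpha> (2 * k))"
  have split: "map ?f [0..<l] = map ?f [0..<k] @ ?f k # map ?f [Suc k..<l]"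
    using upt_split[OF k] by simp
  have "dim_vec v = dim_col (diag_block_mat (map ?f [0..<l]))"
    using v by (simp add: dim_diag_block_mat comp_def sum_list_triv)
  then have "(cmv_L l \<alpha> *\<^sub>v v) $ (2 * k + i) = (\<Sum>j<2. ?f k $$ (i, j) * v $ (2 * k + j))"
    if "i < 2" for i
    unfolding cmv_L_def split using that
    by (subst diag_block_mat_mult_vec) (auto simp: comp_def sum_list_triv)
  from this[of 0] this[of 1] show ?A ?B
    by (simp_all add: numeral_2_eq_2 Theta_index)
qed

lemma cmv_M_mult_vec:
  assumes l: "l \<ge> 1" and v: "dim_vec v = 2 * l"
  shows "(cmv_M l \<alpha> *\<^sub>v v) $ 0 = v $ 0" (is ?A)
    and "(cmv_M l \<alpha> *\<^sub>v v) $ (2 * l - 1) = v $ (2 * l - 1)" (is ?B)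
    and "k < l - 1 \<Longrightarrow> (cmv_M l \<alpha> *\<^sub>v v) $ Suc (2 * k)
      = cnj (\<alpha> (2 * k + 1)) * v $ Suc (2 * k) + rho (\<alpha> (2 * k + 1)) * v $ Suc (Suc (2 * k))"
    and "k < l - 1 \<Longrightarrow> (cmv_M l \<alpha> *\<^sub>v v) $ Suc (Suc (2 * k))
      = rho (\<alpha> (2 * k + 1)) * v $ Suc (2 * k) - \<alpha> (2 * k + 1) * v $ Suc (Suc (2 * k))"
proof -
  let ?f = "\<lambda>k. Theta (\<alpha> (2 * k + 1))"
  let ?T = "1\<^sub>m 1 # map ?f [0..<l - 1] @ [1\<^sub>m 1]"
  have dim: "dim_vec v = dim_col (diag_block_mat ?T)"
    using v l by (simp add: dim_diag_block_mat comp_def sum_list_triv)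
  show ?A
    using diag_block_mat_mult_vec[of "[]" 0 "1\<^sub>m 1" v "map ?f [0..<l - 1] @ [1\<^sub>m 1]" 0] dim
    by (simp add: cmv_M_def)
  have s: "2 * l - 1 = sum_list (map dim_col (1\<^sub>m 1 # map ?f [0..<l - 1]))"
    using l by (simp add: comp_def sum_list_triv)
  have "(diag_block_mat ((1\<^sub>m 1 # map ?f [0..<l - 1]) @ 1\<^sub>m 1 # []) *\<^sub>v v) $ (2 * l - 1 + 0)
      = (\<Sum>j<dim_col (1\<^sub>m 1 :: complex mat). 1\<^sub>m 1 $$ (0, j) * v $ (2 * l - 1 + j))"
    by (rule diag_block_mat_mult_vec[OF _ _ _ s])
      (use dim in \<open>auto simp del: diag_block_mat.simps\<close>)
  then show ?B
    by (simp add: cmv_M_def del: diag_block_mat.simps)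
  {
    assume k: "k < l - 1"
    have split: "?T = (1\<^sub>m 1 # map ?f [0..<k]) @ ?f k # map ?f [Suc k..<l - 1] @ [1\<^sub>m 1]"
      using upt_split[OF k] by simp
    have "(cmv_M l \<alpha> *\<^sub>v v) $ (Suc (2 * k) + i) = (\<Sum>j<2. ?f k $$ (i, j) * v $ (Suc (2 * k) + j))"
      if "i < 2" for i
      unfolding cmv_M_def split using that dim[unfolded split]
      by (subst diag_block_mat_mult_vec) (auto simp: comp_def sum_list_triv)
    note this[of 0] this[of 1]
  }
  note entry = this
  show "k < l - 1 \<Longrightarrow> (cmv_M l \<alpha> *\<^sub>v v) $ Suc (2 * k)
      = cnj (\<alpha> (2 * k + 1)) * v $ Suc (2 * k) + rho (\<alpha> (2 * k + 1)) * v $ Suc (Suc (2 * k))"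
    and "k < l - 1 \<Longrightarrow> (cmv_M l \<alpha> *\<^sub>v v) $ Suc (Suc (2 * k))
      = rho (\<alpha> (2 * k + 1)) * v $ Suc (2 * k) - \<alpha> (2 * k + 1) * v $ Suc (Suc (2 * k))"
    using entry by (simp_all add: numeral_2_eq_2 Theta_index)
qed

text \<open>A relation \<open>(s, t) = \<Theta>(a) (x, y)\<close> between the values at two neighbouring positions,
  solved for the second position: up to the factor \<open>\<rho>\<close> this is a step of the Szego recursion.\<close>

lemma Theta_relation_solved:
  assumes "cmod a < 1" and s: "s = cnj a * x + rho a * y" and t: "t = rho a * x - a * y"
  shows "rho a * y = s - cnj a * x" and "rho a * t = x - a * s"
proof -
  show "rho a * y = s - cnj a * x"
    using s by simp
  have "rho a * t = (rho a * rho a) * x - a * (rho a * y)"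
    unfolding t by (simp add: algebra_simps)
  also have "\<dots> = x - a * s"
    unfolding rho_square(2)[OF assms(1)] s by (simp add: algebra_simps)
  finally show "rho a * t = x - a * s" .
qed

text \<open>Let \<open>v\<close> be an eigenvector and \<open>w = \<M> v\<close>, so that \<open>\<L> w = z v\<close>. The pair
  \<open>(v\<^sub>k, w\<^sub>k)\<close> for even \<open>k\<close>, or \<open>(w\<^sub>k, z v\<^sub>k)\<close> for odd \<open>k\<close>, is proportional to
  \<open>(\<Phi>\<^sub>k(z), \<Phi>\<^sub>k\<^sup>*(z))\<close>: at \<open>k = 0\<close> because \<open>w\<^sub>0 = v\<^sub>0\<close>, and then block by
  block. At \<open>k = n - 1\<close> the relation \<open>w\<^sub>k = v\<^sub>k\<close> becomes the equation for \<open>z\<close>.\<close>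

lemma eigenvalue_cmv_root:
  assumes n: "even n" "n \<ge> 2" and \<alpha>: "\<And>k. k < n - 1 \<Longrightarrow> cmod (\<alpha> k) < 1"
    and ev: "eigenvalue (cmv n \<alpha>) z"
  shows "poly (Szego_tilde \<alpha> (n - 1)) z = 0"
proof -
  obtain l where l: "n = 2 * l" "l \<ge> 1"
    using n by auto
  obtain v where "eigenvector (cmv n \<alpha>) v z"
    using ev by (auto simp: eigenvalue_def)
  moreover have "dim_row (cmv n \<alpha>) = n"
    using cmv_carrier[OF n] by (rule carrier_matD)
  ultimately have v: "dim_vec v = n" "v \<noteq> 0\<^sub>v n" "cmv n \<alpha> *\<^sub>v v = z \<cdot>\<^sub>v v"
    unfolding eigenvector_def by (auto dest: carrier_vecD)
  define w where "w = cmv_M l \<alpha> *\<^sub>v v"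
  have L: "cmv_L l \<alpha> \<in> carrier_mat n n"
    unfolding l(1) by (rule carrier_matI) (simp_all add: cmv_L_def dim_diag_block_mat comp_def sum_list_triv)
  have M: "cmv_M l \<alpha> \<in> carrier_mat n n"
    using l(2) unfolding l(1)
    by (intro carrier_matI) (simp_all add: cmv_M_def dim_diag_block_mat comp_def sum_list_triv)
  have "v \<in> carrier_vec n"
    using v(1) by (rule carrier_vecI)
  then have "cmv n \<alpha> *\<^sub>v v = cmv_L l \<alpha> *\<^sub>v w"
    unfolding cmv_def w_def l(1) using L M by (simp add: l(1))
  then have Lw: "cmv_L l \<alpha> *\<^sub>v w = z \<cdot>\<^sub>v v"
    by (simp only: v(3))
  have dw: "dim_vec w = 2 * l"
    using M l by (simp add: w_def)
  have Lk: "rho (\<alpha> (2 * k)) * w $ Suc (2 * k) = z * v $ (2 * k) - cnj (\<alpha> (2 * k)) * w $ (2 * k)"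
    "rho (\<alpha> (2 * k)) * (z * v $ Suc (2 * k)) = w $ (2 * k) - \<alpha> (2 * k) * (z * v $ (2 * k))"
    if "k < l" for k
    using Theta_relation_solved[of "\<alpha> (2 * k)" "z * v $ (2 * k)" "w $ (2 * k)" "w $ Suc (2 * k)"
        "z * v $ Suc (2 * k)"] cmv_L_mult_vec[OF that dw, of \<alpha>] Lw v(1) that l \<alpha>[of "2 * k"]
    by simp_all
  have Mk: "rho (\<alpha> (Suc (2 * k))) * v $ Suc (Suc (2 * k))
      = w $ Suc (2 * k) - cnj (\<alpha> (Suc (2 * k))) * v $ Suc (2 * k)"
    "rho (\<alpha> (Suc (2 * k))) * w $ Suc (Suc (2 * k))
      = v $ Suc (2 * k) - \<alpha> (Suc (2 * k)) * w $ Suc (2 * k)"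
    if "k < l - 1" for k
    using Theta_relation_solved[of "\<alpha> (Suc (2 * k))" "w $ Suc (2 * k)" "v $ Suc (2 * k)"
        "v $ Suc (Suc (2 * k))" "w $ Suc (Suc (2 * k))"]
      cmv_M_mult_vec(3,4)[OF l(2) v(1)[unfolded l(1)] that, of \<alpha>] that l \<alpha>[of "Suc (2 * k)"]
    by (simp_all add: w_def)
  have w0: "w $ 0 = v $ 0" and wl: "w $ (n - 1) = v $ (n - 1)"
    using cmv_M_mult_vec(1,2)[OF l(2) v(1)[unfolded l(1)], of \<alpha>] l by (simp_all add: w_def)
  have rho: "rho (\<alpha> k) \<noteq> 0" if "k < n - 1" for k
    using rho_square(1)[OF \<alpha>[OF that]] .

  \<comment> \<open>The case \<open>z = 0\<close> is impossible, since both factors are invertible.\<close>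
  have z: "z \<noteq> 0"
  proof
    assume z: "z = 0"
    have even0: "w $ (2 * k) = 0" "w $ Suc (2 * k) = 0" if "k < l" for k
      using Lk[OF that] z rho[of "2 * k"] that l by auto
    have w_zero: "w $ i = 0" if "i < n" for i
      using even0[of "i div 2"] that l(1)
      by (cases "even i") (auto elim!: evenE oddE)
    have "v $ i = 0" if "i < n" for i
    proof -
      have "i = 0 \<or> i = n - 1 \<or> (\<exists>k<l - 1. i = Suc (2 * k) \<or> i = Suc (Suc (2 * k)))"
        using \<open>i < n\<close> l by presburger
      then consider "i = 0" | "i = n - 1" | k where "i = Suc (2 * k)" "k < l - 1"
        | k where "i = Suc (Suc (2 * k))" "k < l - 1" by blast
      then show ?thesis
      proof cases
        case 1 then show ?thesis using w0 w_zero[of 0] l by simp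
      next
        case 2 then show ?thesis using wl w_zero[of "n - 1"] l by simp
      next
        case 3
        then show ?thesis using Mk(2)[OF 3(2)] w_zero l by simp
      next
        case 4
        have "v $ Suc (2 * k) = 0"
          using Mk(2)[OF 4(2)] w_zero 4 l by simp
        then show ?thesis using Mk(1)[OF 4(2)] w_zero 4 l rho[of "Suc (2 * k)"] by simp
      qed
    qed
    then show False
      using v(1,2) by (metis eq_vecI index_zero_vec)
  qed

  define a where "a k = (if even k then v $ k else w $ k)" for k
  define b where "b k = (if even k then w $ k else z * v $ k)" for k
  let ?P = "\<lambda>k. poly (Szego \<alpha> k) z" and ?Q = "\<lambda>k. poly (Szego_star \<alpha> k) z"
  have proportional: "\<exists>c. c \<noteq> 0 \<and> c * a k = v $ 0 * ?P k \<and> c * b k = v $ 0 * ?Q k" if "k < n" for k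
    using that
  proof (induction k)
    case 0
    then show ?case
      using w0 by (intro exI[of _ 1]) (simp add: a_def b_def star_poly_def)
  next
    case (Suc k)
    then obtain c where c: "c \<noteq> 0" "c * a k = v $ 0 * ?P k" "c * b k = v $ 0 * ?Q k"
      by auto
    have "\<exists>e. e \<noteq> 0 \<and> e * a (Suc k) = z * a k - cnj (\<alpha> k) * b k
        \<and> e * b (Suc k) = b k - \<alpha> k * (z * a k)"
    proof (cases "even k")
      case True
      then obtain j where j: "k = 2 * j" by blast
      then have "j < l" using Suc.prems l by simp
      then show ?thesis
        using Lk[of j] rho[of k] Suc.prems j by (intro exI[of _ "rho (\<alpha> k)"]) (simp add: a_def b_def)
    next
      case False
      then obtain j where j: "k = Suc (2 * j)" by (auto elim: oddE)
      then have "j < l - 1" using Suc.prems l by simp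
      from Mk[OF this] show ?thesis
        using rho[of k] Suc.prems j z
        by (intro exI[of _ "z * rho (\<alpha> k)"])
           (auto simp: a_def b_def mult.assoc right_diff_distrib mult.left_commute)
    qed
    then obtain e where e: "e \<noteq> 0" "e * a (Suc k) = z * a k - cnj (\<alpha> k) * b k"
      "e * b (Suc k) = b k - \<alpha> k * (z * a k)" by blast
    have "(c * e) * a (Suc k) = z * (c * a k) - cnj (\<alpha> k) * (c * b k)"
      unfolding mult.assoc e(2) by (simp add: algebra_simps)
    moreover have "(c * e) * b (Suc k) = c * b k - \<alpha> k * (z * (c * a k))"
      unfolding mult.assoc e(3) by (simp add: algebra_simps)
    ultimately have "(c * e) * a (Suc k) = v $ 0 * ?P (Suc k)"
      "(c * e) * b (Suc k) = v $ 0 * ?Q (Suc k)"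
      unfolding c(2,3) poly_Szego_Suc poly_Szego_star_Suc by (simp_all add: right_diff_distrib ac_simps)
    moreover have "c * e \<noteq> 0"
      using c(1) e(1) by simp
    ultimately show ?case by blast
  qed
  have "v $ 0 \<noteq> 0"
  proof
    assume v0: "v $ 0 = 0"
    have "v $ k = 0" if "k < n" for k
      using proportional[OF that] v0 z by (cases "even k") (auto simp: a_def b_def)
    then show False
      using v(1,2) by (metis eq_vecI index_zero_vec)
  qed
  obtain c where c: "c * a (n - 1) = v $ 0 * ?P (n - 1)" "c * b (n - 1) = v $ 0 * ?Q (n - 1)"
    using proportional[of "n - 1"] n by auto
  have "b (n - 1) = z * a (n - 1)"
    using wl n by (simp add: a_def b_def)
  then have "v $ 0 * (z * ?P (n - 1)) = v $ 0 * ?Q (n - 1)"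
    using c by (metis mult.left_commute)
  then show ?thesis
    using \<open>v $ 0 \<noteq> 0\<close> by (simp add: poly_Szego_tilde)
qed


section \<open>The solution of the interpolation problem given by the parameters\<close>

text \<open>Multiplying the row vector \<open>(z A, - A\<^sup>*)\<close> from the right by the transfer matrix of a parameter
  \<open>\<alpha>\<close> gives again a row of this form, where \<open>A\<close> is replaced by \<open>z A + \<alpha> A\<^sup>*\<close>. So the last
  parameters act as a Szego recursion in reverse order, with \<open>\<alpha>\<close> replaced by \<open>- cnj \<alpha>\<close>.\<close>

lemma Szego_tilde_split:
  fixes q :: nat and \<alpha> :: "nat \<Rightarrow> complex"
  defines "\<gamma> \<equiv> \<lambda>i. - cnj (\<alpha> (q - 1 - i))"
  assumes "j \<le> q"
  shows "poly (Szego_tilde \<alpha> q) z = z * poly (Szego \<gamma> j) z * poly (Szego \<alpha> (q - j)) z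
      - poly (Szego_star \<gamma> j) z * poly (Szego_star \<alpha> (q - j)) z"
  using assms(2)
proof (induction j)
  case 0
  then show ?case by (simp add: poly_Szego_tilde star_poly_def)
next
  case (Suc j)
  define k where "k = q - Suc j"
  have k: "q - j = Suc k" and \<gamma>: "\<gamma> j = - cnj (\<alpha> k)"
    using Suc.prems by (auto simp: k_def \<gamma>_def)
  have "poly (Szego_tilde \<alpha> q) z = z * poly (Szego \<gamma> j) z * poly (Szego \<alpha> (Suc k)) z
      - poly (Szego_star \<gamma> j) z * poly (Szego_star \<alpha> (Suc k)) z"
    using Suc k by simp
  then show ?case
    unfolding k_def[symmetric] poly_Szego_Suc poly_Szego_star_Suc \<gamma> by (simp add: algebra_simps)
qed

lemma omega_eq:
  assumes \<alpha>: "\<And>i. i \<le> N \<Longrightarrow> cmod (\<alpha> i) < 1" and z: "cmod z = 1"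
  shows "omega \<alpha> N z = z * (1 - poly (Szego \<alpha> (Suc N)) z / poly (Szego_star \<alpha> (Suc N)) z)"
proof -
  define p q a where "p = poly (Szego \<alpha> N) z" and "q = poly (Szego_star \<alpha> N) z" and "a = \<alpha> N"
  have zz: "z * cnj z = 1"
    using z by (simp add: complex_norm_square[symmetric])
  then have z0: "z \<noteq> 0" by auto
  then have cz: "cnj z = 1 / z"
    using zz by (simp add: field_simps)
  have p: "p \<noteq> 0"
    using Szego_neq_0_on_circle(1)[of N \<alpha> z] \<alpha> z by (simp add: p_def)
  have q': "poly (Szego_star \<alpha> (Suc N)) z = q - a * (z * p)"
    by (simp add: poly_Szego_star_Suc p_def q_def a_def)
  have d: "q - a * (z * p) \<noteq> 0"
    using Szego_neq_0_on_circle(2)[of "Suc N" \<alpha> z] \<alpha> z q' by simp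
  have W: "W \<alpha> N z = z - q / p"
    using p by (simp add: W_def poly_Szego_tilde p_def q_def diff_divide_distrib)
  have den: "1 - a - cnj z * W \<alpha> N z = (q - a * (z * p)) / (z * p)"
    unfolding W cz using z0 p by (simp add: field_simps)
  have aa: "complex_of_real (1 - (cmod a)\<^sup>2) = 1 - a * cnj a"
    by (simp only: of_real_diff of_real_1 complex_norm_square)
  have "omega \<alpha> N z = z * (((1 + cnj a) * ((q - a * (z * p)) / (z * p)) - (1 - a * cnj a))
      / ((q - a * (z * p)) / (z * p)))"
    unfolding omega_def a_def[symmetric] den aa ..
  also have "((1 + cnj a) * ((q - a * (z * p)) / (z * p)) - (1 - a * cnj a))
      / ((q - a * (z * p)) / (z * p))
      = ((1 + cnj a) * (q - a * (z * p)) - (1 - a * cnj a) * (z * p)) / (q - a * (z * p))"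
    using z0 p d by (simp add: divide_simps)
  also have "(1 + cnj a) * (q - a * (z * p)) - (1 - a * cnj a) * (z * p)
      = (q - a * (z * p)) - (z * p - cnj a * q)"
    by (simp add: algebra_simps)
  also have "\<dots> / (q - a * (z * p)) = 1 - (z * p - cnj a * q) / (q - a * (z * p))"
    using d by (simp add: diff_divide_distrib)
  finally show ?thesis
    unfolding q' by (simp add: poly_Szego_Suc p_def q_def a_def)
qed

text \<open>The polynomial \<open>A\<close> that collects the last \<open>m\<close> parameters in reverse order, starting from
  \<open>\<alpha>\<^sub>n\<^sub>-\<^sub>2\<close>.\<close>

definition tail_poly :: "nat \<Rightarrow> nat \<Rightarrow> (nat \<Rightarrow> complex) \<Rightarrow> complex poly" where
  "tail_poly n m \<alpha> = Szego (\<lambda>i. - cnj (\<alpha> (n - 2 - i))) m"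

text \<open>At an eigenvalue, division of \<open>z A \<Phi>\<^sub>K = A\<^sup>* \<Phi>\<^sub>K\<^sup>*\<close> by \<open>\<Phi>\<^sub>K\<^sup>*\<close> gives
  \<open>A\<^sup>* = (z - \<omega>) A\<close>.\<close>

lemma tail_poly_interpolates:
  assumes n: "even n" "m + 2 \<le> n" and \<alpha>: "\<And>k. k \<le> n - 2 \<Longrightarrow> cmod (\<alpha> k) < 1"
    and ev: "eigenvalue (cmv n \<alpha>) z"
  shows "cmod z = 1"
    and "poly ([:0, 1:] * tail_poly n m \<alpha> - star_poly m (tail_poly n m \<alpha>)) z
      = omega \<alpha> (n - m - 2) z * poly (tail_poly n m \<alpha>) z"
proof -
  have root: "poly (Szego_tilde \<alpha> (n - 1)) z = 0"
    using n \<alpha> ev by (intro eigenvalue_cmv_root) auto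
  show z: "cmod z = 1"
    using n \<alpha> by (intro Szego_tilde_root_unimodular[OF _ root]) auto
  let ?A = "tail_poly n m \<alpha>" and ?K = "Suc (n - m - 2)"
  have K: "n - 1 - m = ?K" and \<gamma>: "(\<lambda>i. - cnj (\<alpha> (n - 1 - 1 - i))) = (\<lambda>i. - cnj (\<alpha> (n - 2 - i)))"
    using n by (auto simp: numeral_2_eq_2)
  have split: "z * poly ?A z * poly (Szego \<alpha> ?K) z = poly (star_poly m ?A) z * poly (Szego_star \<alpha> ?K) z"
    using Szego_tilde_split[of m "n - 1" \<alpha> z] n root unfolding K \<gamma> tail_poly_def by simp
  have nz: "poly (Szego_star \<alpha> ?K) z \<noteq> 0"
    using \<alpha> n z by (intro Szego_neq_0_on_circle) auto
  have om: "omega \<alpha> (n - m - 2) z = z * (1 - poly (Szego \<alpha> ?K) z / poly (Szego_star \<alpha> ?K) z)"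
    using \<alpha> n z by (intro omega_eq) auto
  have "poly (star_poly m ?A) z = z * poly ?A z * (poly (Szego \<alpha> ?K) z / poly (Szego_star \<alpha> ?K) z)"
    using split nz by (simp add: nonzero_eq_divide_eq)
  then show "poly ([:0, 1:] * ?A - star_poly m ?A) z = omega \<alpha> (n - m - 2) z * poly ?A z"
    unfolding om by (simp add: algebra_simps)
qed

lemma tail_poly_normalized:
  fixes m :: nat
  defines "P A \<equiv> [:0, 1:] * A - star_poly m A"
  shows "degree (tail_poly n m \<alpha>) = m" "lead_coeff (tail_poly n m \<alpha>) = 1"
    and "degree (P (tail_poly n m \<alpha>)) = m + 1" "lead_coeff (P (tail_poly n m \<alpha>)) = 1"
    and "poly (P (tail_poly n m \<alpha>)) 0 = - 1"
proof -
  let ?A = "tail_poly n m \<alpha>"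
  show A: "degree ?A = m" "lead_coeff ?A = 1"
    unfolding tail_poly_def using lead_coeff_Szego by blast+
  have c: "coeff (P ?A) (m + 1) = 1"
    using A by (simp add: P_def coeff_star_poly)
  have "degree (P ?A) \<le> m + 1"
    unfolding P_def using A degree_star_poly[of m ?A] degree_mult_le[of "[:0, 1:]" ?A]
    by (intro degree_diff_le) auto
  moreover have "m + 1 \<le> degree (P ?A)"
    using c by (intro le_degree) simp
  ultimately show d: "degree (P ?A) = m + 1" by simp
  show "lead_coeff (P ?A) = 1"
    unfolding d by (rule c)
  show "poly (P ?A) 0 = - 1"
    by (simp add: P_def tail_poly_def poly_Szego_star_0)
qed

lemma coprime_if_no_common_zero:
  fixes p q :: "complex poly"
  assumes "\<And>z. poly p z \<noteq> 0 \<or> poly q z \<noteq> 0"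
  shows "coprime p q"
proof (rule coprimeI)
  fix c assume "c dvd p" "c dvd q"
  then have "poly c z \<noteq> 0" for z
    using assms[of z] by (auto elim!: dvdE)
  moreover from this[of 0] have "c \<noteq> 0" by auto
  ultimately show "is_unit c"
    using fundamental_theorem_of_algebra[of c] by (auto simp: constant_degree is_unit_iff_degree)
qed

text \<open>A common zero of the pair is a common zero of \<open>A\<close> and \<open>A\<^sup>*\<close>.\<close>

lemma tail_poly_coprime:
  assumes \<alpha>: "\<And>k. k \<le> n - 2 \<Longrightarrow> cmod (\<alpha> k) < 1"
  shows "coprime ([:0, 1:] * tail_poly n m \<alpha> - star_poly m (tail_poly n m \<alpha>)) (tail_poly n m \<alpha>)"
proof (rule coprime_if_no_common_zero)
  fix z
  show "poly ([:0, 1:] * tail_poly n m \<alpha> - star_poly m (tail_poly n m \<alpha>)) z \<noteq> 0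
      \<or> poly (tail_poly n m \<alpha>) z \<noteq> 0"
    using Szego_no_common_zero[of m "\<lambda>i. - cnj (\<alpha> (n - 2 - i))" z] \<alpha>
    by (auto simp: tail_poly_def)
qed


section \<open>Uniqueness of the normalized solution\<close>

lemma height_le_iff:
  assumes "m \<ge> 1"
  shows "height (p, q) \<le> ereal (2 * real m) \<longleftrightarrow> degree p \<le> m \<and> degree q < m"
proof -
  have "2 * edegree p \<le> ereal (2 * real m) \<longleftrightarrow> degree p \<le> m"
    by (cases "p = 0") (auto simp: edegree_def)
  moreover have "2 * edegree q + 1 \<le> ereal (2 * real m) \<longleftrightarrow> degree q < m"
    using assms by (cases "q = 0") (auto simp: edegree_def one_ereal_def)
  ultimately show ?thesis
    by (simp add: height_def)
qed

text \<open>At a node, both solutions are multiples of \<open>(\<omega>, 1)\<close>, so their cross product vanishes.\<close>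

lemma solves_interp_cross_eq:
  assumes inj: "inj_on \<zeta> {1..M}"
    and p: "solves_interp M \<zeta> \<omega> (p1, p2)" and q: "solves_interp M \<zeta> \<omega> (q1, q2)"
    and deg: "degree (p1 * q2) < M" "degree (p2 * q1) < M"
  shows "p1 * q2 = p2 * q1"
proof (rule ccontr)
  let ?c = "p1 * q2 - p2 * q1"
  assume "p1 * q2 \<noteq> p2 * q1"
  then have c: "?c \<noteq> 0" by simp
  have "poly ?c (\<zeta> j) = 0" if "j \<in> {1..M}" for j
    using p q that by (simp add: solves_interp_def)
  then have "\<zeta> ` {1..M} \<subseteq> {x. poly ?c x = 0}" by blast
  then have "card (\<zeta> ` {1..M}) \<le> card {x. poly ?c x = 0}"
    using poly_roots_finite[OF c] by (rule card_mono[rotated])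
  also have "\<dots> \<le> degree ?c"
    using c by (rule card_poly_roots_bound)
  also have "\<dots> < M"
    using deg by (rule degree_diff_less)
  finally show False
    using inj by (simp add: card_image)
qed

lemma degree_diff_monic_less:
  fixes p q :: "complex poly"
  assumes "degree p = Suc k" "lead_coeff p = 1" "degree q = Suc k" "lead_coeff q = 1"
  shows "degree (p - q) \<le> k"
proof (rule degree_le, intro allI impI)
  fix i assume "i > k"
  then show "coeff (p - q) i = 0"
    using assms by (cases "i = Suc k") (auto simp: coeff_eq_0)
qed

text \<open>The coprime solution \<open>(P1, P2)\<close> excludes solutions of small degree, and the minimal generator
  excludes a difference that does not vanish at \<open>0\<close>.\<close>

lemma normalized_solution_unique:
  assumes m: "m \<ge> 1" and inj: "inj_on \<zeta> {1..2 * m}" and nz: "\<And>j. j \<in> {1..2 * m} \<Longrightarrow> \<zeta> j \<noteq> 0"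
    and R: "minimal_generator (2 * m) \<zeta> \<omega> (R1, R2)" "poly R1 0 \<noteq> 0"
    and P: "solves_interp (2 * m) \<zeta> \<omega> (P1, P2)" "degree P1 = m + 1" "lead_coeff P1 = 1"
      "degree P2 = m" "lead_coeff P2 = 1" "poly P1 0 = - 1" and cop: "coprime P1 P2"
    and Q: "solves_interp (2 * m) \<zeta> \<omega> (Q1, Q2)" "degree Q1 = m + 1" "lead_coeff Q1 = 1"
      "degree Q2 = m" "lead_coeff Q2 = 1" "poly Q1 0 = - 1"
  shows "Q1 = P1 \<and> Q2 = P2"
proof (rule ccontr)
  assume neq: "\<not> (Q1 = P1 \<and> Q2 = P2)"
  define D1 D2 where "D1 = Q1 - P1" and "D2 = Q2 - P2"
  have sD: "solves_interp (2 * m) \<zeta> \<omega> (D1, D2)"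
    using P(1) Q(1) by (simp add: solves_interp_def D1_def D2_def algebra_simps)
  have dD1: "degree D1 \<le> m"
    unfolding D1_def using P Q by (intro degree_diff_monic_less) auto
  have "degree D2 \<le> m - 1"
    unfolding D2_def using P Q m by (intro degree_diff_monic_less) auto
  then have dD2: "degree D2 < m"
    using m by simp
  have "height (R1, R2) \<le> height (D1, D2)"
    using R(1) sD neq by (auto simp: minimal_generator_def D1_def D2_def)
  also have "\<dots> \<le> ereal (2 * real m)"
    using height_le_iff[OF m] dD1 dD2 by blast
  finally have dR: "degree R1 \<le> m" "degree R2 < m"
    using height_le_iff[OF m] by blast+
  have "R1 * D2 = R2 * D1"
  proof (rule solves_interp_cross_eq[OF inj _ sD])
    show "solves_interp (2 * m) \<zeta> \<omega> (R1, R2)"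
      using R(1) by (simp add: minimal_generator_def)
    show "degree (R1 * D2) < 2 * m" "degree (R2 * D1) < 2 * m"
      using degree_mult_le[of R1 D2] degree_mult_le[of R2 D1] dR dD1 dD2 by linarith+
  qed
  then have "poly R1 0 * poly D2 0 = poly R2 0 * poly D1 0"
    by (metis poly_mult)
  moreover have D10: "poly D1 0 = 0"
    using P(6) Q(6) by (simp add: D1_def)
  ultimately have "poly D2 0 = 0"
    using R(2) by simp
  with D10 obtain E1 E2 where E: "D1 = [:0, 1:] * E1" "D2 = [:0, 1:] * E2"
    by (auto simp: poly_eq_0_iff_dvd elim!: dvdE)
  have sE: "solves_interp (2 * m) \<zeta> \<omega> (E1, E2)"
    unfolding solves_interp_def
  proof
    fix j assume j: "j \<in> {1..2 * m}"
    then have "\<zeta> j * (poly E1 (\<zeta> j) - \<omega> j * poly E2 (\<zeta> j)) = 0"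
      using sD E by (auto simp: solves_interp_def algebra_simps)
    then show "poly (fst (E1, E2)) (\<zeta> j) - \<omega> j * poly (snd (E1, E2)) (\<zeta> j) = 0"
      using nz[OF j] by simp
  qed
  have dE1: "degree E1 \<le> m - 1"
    using dD1 E(1) by (cases "E1 = 0") auto
  have dE2: "E2 = 0 \<or> degree E2 + 1 < m"
    using dD2 E(2) by (cases "E2 = 0") auto
  have eq: "E1 * P2 = E2 * P1"
  proof (rule solves_interp_cross_eq[OF inj sE P(1)])
    show "degree (E1 * P2) < 2 * m"
      using degree_mult_le[of E1 P2] dE1 P(4) m by linarith
    show "degree (E2 * P1) < 2 * m"
      using degree_mult_le[of E2 P1] dE2 P(2) m by auto
  qed
  then have "P1 dvd E1 * P2" by simp
  then have "P1 dvd E1"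
    using cop by (simp add: coprime_dvd_mult_left_iff)
  then have "E1 = 0"
    using dE1 P(2) by (cases "E1 = 0") (auto dest: dvd_imp_degree_le)
  moreover from this have "E2 = 0"
    using eq P(2) by auto
  ultimately show False
    using neq E by (simp add: D1_def D2_def)
qed

theorem theorem3p3:
  fixes n m :: nat and \<alpha> \<zeta> :: "nat \<Rightarrow> complex" and R1 R2 :: "complex poly"
  assumes "even n" and "n \<ge> 4" and "1 \<le> m" and "m \<le> n div 2"
    and "\<And>k. k \<le> n - 2 \<Longrightarrow> cmod (\<alpha> k) < 1"
    and "inj_on \<zeta> {1..2 * m}"
    and "\<And>j. j \<in> {1..2 * m} \<Longrightarrow> eigenvalue (cmv n \<alpha>) (\<zeta> j)"
    and "minimal_generator (2 * m) \<zeta> (\<lambda>j. omega \<alpha> (n - m - 2) (\<zeta> j)) (R1, R2)"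
    and "poly R1 0 \<noteq> 0"
  shows "(\<exists>!(P1, P2). solves_interp (2 * m) \<zeta> (\<lambda>j. omega \<alpha> (n - m - 2) (\<zeta> j)) (P1, P2) \<and>
            degree P1 = m + 1 \<and> lead_coeff P1 = 1 \<and>
            degree P2 = m \<and> lead_coeff P2 = 1 \<and> poly P1 0 = - 1) \<and>
         (\<forall>\<alpha>' :: nat \<Rightarrow> complex.
            (\<forall>k\<in>{n - m - 1..n - 2}. cmod (\<alpha>' k) < 1) \<and>
            (\<forall>j\<in>{1..2 * m}.
               eigenvalue (cmv n (\<lambda>k. if k \<le> n - m - 2 then \<alpha> k else \<alpha>' k)) (\<zeta> j)) \<longrightarrow>
            (\<forall>k\<in>{n - m - 1..n - 2}. \<alpha>' k = \<alpha> k))"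
proof -
  let ?N = "n - m - 2"
  let ?\<omega> = "\<lambda>j. omega \<alpha> ?N (\<zeta> j)"
  let ?P = "\<lambda>A. [:0, 1:] * A - star_poly m A"
  let ?S = "\<lambda>P1 P2. solves_interp (2 * m) \<zeta> ?\<omega> (P1, P2) \<and> degree P1 = m + 1 \<and> lead_coeff P1 = 1 \<and>
      degree P2 = m \<and> lead_coeff P2 = 1 \<and> poly P1 0 = - 1"
  have mn: "m + 2 \<le> n"
    using assms(1-4) by presburger
  have sol: "?S (?P (tail_poly n m \<beta>)) (tail_poly n m \<beta>)"
    if \<beta>: "\<And>k. k \<le> n - 2 \<Longrightarrow> cmod (\<beta> k) < 1"
      and ev: "\<And>j. j \<in> {1..2 * m} \<Longrightarrow> eigenvalue (cmv n \<beta>) (\<zeta> j)"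
      and agree: "\<And>k. k \<le> ?N \<Longrightarrow> \<beta> k = \<alpha> k" for \<beta>
  proof -
    have "Szego \<beta> ?N = Szego \<alpha> ?N"
      using agree by (intro Szego_cong) simp
    then have om: "omega \<beta> ?N z = omega \<alpha> ?N z" for z
      using agree[of ?N] by (simp add: omega_def W_def Szego_tilde_def)
    have "solves_interp (2 * m) \<zeta> ?\<omega> (?P (tail_poly n m \<beta>), tail_poly n m \<beta>)"
      using tail_poly_interpolates(2)[OF assms(1) mn \<beta> ev] om by (simp add: solves_interp_def)
    then show ?thesis
      using tail_poly_normalized[of n m \<beta>] by blast
  qed
  let ?A = "tail_poly n m \<alpha>"
  have solA: "?S (?P ?A) ?A"
    using assms(5,7) by (intro sol) auto
  have nz: "\<zeta> j \<noteq> 0" if "j \<in> {1..2 * m}" for j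
    using tail_poly_interpolates(1)[OF assms(1) mn assms(5) assms(7)[OF that]] by auto
  have cop: "coprime (?P ?A) ?A"
    using assms(5) by (rule tail_poly_coprime)
  have uniq: "Q1 = ?P ?A \<and> Q2 = ?A" if "?S Q1 Q2" for Q1 Q2
    using normalized_solution_unique[OF assms(3,6) nz assms(8,9), of "?P ?A" ?A Q1 Q2] solA cop that
    by blast
  show ?thesis
  proof (intro conjI allI impI ballI)
    show "\<exists>!(P1, P2). ?S P1 P2"
      using solA uniq by (intro ex1I[of _ "(?P ?A, ?A)"]) auto
  next
    fix \<alpha>' :: "nat \<Rightarrow> complex" and k
    let ?\<beta> = "\<lambda>k. if k \<le> ?N then \<alpha> k else \<alpha>' k"
    assume \<alpha>': "(\<forall>k\<in>{n - m - 1..n - 2}. cmod (\<alpha>' k) < 1) \<and>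
        (\<forall>j\<in>{1..2 * m}. eigenvalue (cmv n ?\<beta>) (\<zeta> j))"
      and k: "k \<in> {n - m - 1..n - 2}"
    have "?S (?P (tail_poly n m ?\<beta>)) (tail_poly n m ?\<beta>)"
      using \<alpha>' assms(5) by (intro sol) auto
    from uniq[OF this] have "tail_poly n m \<alpha> = tail_poly n m ?\<beta>"
      by (simp only: simp_thms)
    then have "Szego (\<lambda>i. - cnj (\<alpha> (n - 2 - i))) m = Szego (\<lambda>i. - cnj (?\<beta> (n - 2 - i))) m"
      by (simp only: tail_poly_def)
    moreover have "n - 2 - k < m" "n - 2 - (n - 2 - k) = k" "\<not> k \<le> ?N"
      using k mn assms(3) by auto
    ultimately show "\<alpha>' k = \<alpha> k"
      using Szego_inject[of m "\<lambda>i. - cnj (\<alpha> (n - 2 - i))" "\<lambda>i. - cnj (?\<beta> (n - 2 - i))" "n - 2 - k"]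
        assms(5) by simp
  qed
qed

end
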